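(* Let $D=(\mathcal L,\mathcal R,\mathcal A,\overline{\phantom{a}})$ be an (arbitrary, possibly non-flat) ABA framework and let $\mathcal F_D=(A,\mathrm{Att},\mathrm{Sup})$ be the instantiated BAF of $D$. Let $\sigma\in\{\mathit{co},\mathit{gr},\mathit{stb}\}$. Then: (i) if $E\in\sigma(\mathcal F_D)$, then $\mathit{asms}(E)\in\sigma(D)$; (ii) if $S\in\sigma(D)$, then $\{x\in A\mid \mathit{asms}(x)\subseteq S\}\in\sigma(\mathcal F_D)$. Moreover, (iii) if $S\in\mathit{ad}(D)$, then $\{x\in A\mid \mathit{asms}(x)\subseteq S\}\in\mathit{ad}(\mathcal F_D)$.
   Context: ABA frameworks. An ABA framework (ABAF) is a tuple $D=(\mathcal L,\mathcal R,\mathcal A,\overline{\phantom{a}})$ where $\mathcal L$ is a set of sentences, $\mathcal R$ is a set of rules $a_0\leftarrow a_1,\dots,a_n$ ($n\ge 0$, $a_i\in\mathcal L$; head $a_0$, body $\{a_1,\dots,a_n\}$), $\mathcal A\subseteq\mathcal L$ is a non-empty set of assumptions, and $\overline{\phantom{a}}:\mathcal A\to\mathcal L$ is a total contrary function. Assumptions may occur as heads of rules. For $S\subseteq\mathcal A$ and $p\in\mathcal L$, write $S\vdash p$ ("$p$ is derivable from $S$") if there is a finite rooted labelled tree with root labelled $p$, whose set of leaf labels is $S$ or $S\cup\{\top\}$ (with $\top\notin\mathcal L$), such that for each inner node $v$ there is a rule $r\in\mathcal R$ with $v$ labelled by the head of $r$ and the children of $v$ labelled bijectively by the body of $r$ (a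 single child labelled $\top$ if the body is empty). In particular $\{a\}\vdash a$ for each $a\in\mathcal A$ (one-node tree). $\mathit{Th}_D(S)=\{p\mid\exists S'\subseteq S: S'\vdash p\}$ and $\mathit{cl}(S)=\mathit{Th}_D(S)\cap\mathcal A$; $S$ is closed if $S=\mathit{cl}(S)$. $S\subseteq\mathcal A$ attacks $T\subseteq\mathcal A$ if $\overline a\in\mathit{Th}_D(S)$ for some $a\in T$; $S$ attacks $a$ if it attacks $\{a\}$; $S$ is conflict-free if it does not attack itself. $S$ defends $a\in\mathcal A$ if $S$ attacks every closed set $T\subseteq\mathcal A$ that attacks $a$; $S$ defends itself if it defends each of its elements, and defends a set if it defends each element. ABA semantics. For conflict-free $S\subseteq\mathcal A$: $S\in\mathit{ad}(D)$ iff $S$ is closed and defends itself; $S\in\mathit{co}(D)$ iff $S\in\mathit{ad}(D)$ and $S$ is a superset of every assumption set it defends; $S\in\mathit{gr}(D)$ iff $S=\bigcap_{T\in\mathit{co}(D)}T$; $S\in\mathit{stb}(D)$ iff $S$ is closed and attacks each $x\in\mathcal A\setminus S$. Convention: if $\mathit{co}(D)=\emptyset$ then $\mathit{gr}(D)=\emptyset$ (there is no grounded extension). BAFs. A bipolar argumentation framework (BAF) is $\mathcal F=(A,\mathrm{Att},\mathrm{Sup})$ with $\mathrm{Att},\mathrm{Sup}\subseteq A\times A$. For $E\subseteq A$, $\mathit{cl}(E)$ is the set of arguments reachable from $E$ by zero or more support edges; $E$ is closed if $E=\mathit{cl}(E)$. $E$ attacks $a$ if $(e,a)\in\mathrm{Att}$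 for some $e\in E$, and attacks a set if it attacks some element of it; $E^+$ is the set of arguments attacked by $E$. $E$ is conflict-free if $E\cap E^+=\emptyset$. $E$ defends $a$ if $E$ attacks each closed set $S\subseteq A$ which attacks $a$; $\Gamma(E)=\{a\in A\mid E\text{ defends }a\}$. For conflict-free $E$: $E\in\mathit{ad}(\mathcal F)$ iff $E$ is closed and $E\subseteq\Gamma(E)$; $E\in\mathit{co}(\mathcal F)$ iff $E\in\mathit{ad}(\mathcal F)$ and $E=\Gamma(E)$; $E\in\mathit{gr}(\mathcal F)$ iff $E=\bigcap_{S\in\mathit{co}(\mathcal F)}S$ (with $\mathit{gr}(\mathcal F)=\emptyset$ if $\mathit{co}(\mathcal F)=\emptyset$); $E\in\mathit{stb}(\mathcal F)$ iff $E$ is closed and $E^+=A\setminus E$. Instantiated BAF. $\mathcal F_D=(A,\mathrm{Att},\mathrm{Sup})$ where $A$ is the set of all arguments $S\vdash p$ of $D$ (identified by their assumption set $S$ and conclusion $p$), $\mathrm{Att}=\{(S\vdash p,\,T\vdash q)\in A^2\mid p\in\{\overline a\mid a\in T\}\}$, and $\mathrm{Sup}=\{(S\vdash p,\,\{a\}\vdash a)\in A^2\mid a\in\mathit{cl}(S)\}$. For an argument, $\mathit{asms}(S\vdash p)=S$; for $E\subseteq A$, $\mathit{asms}(E)=\bigcup_{x\in E}\mathit{asms}(x)$. *)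

theory Defs
  imports Main
begin

section \<open>Assumption-based argumentation frameworks\<close>

text \<open>A rule is the pair of its head and its body; bodies are required to be finite in
  \<open>wf_abaf\<close>.\<close>

type_synonym 'l rule = "'l \<times> 'l set"

record 'l abaf =
  sentences :: "'l set"
  rules :: "'l rule set"
  assumptions :: "'l set"
  contrary :: "'l \<Rightarrow> 'l"

text \<open>The contrary is only meaningful on assumptions. Assumptions may be heads of rules, so
  frameworks need not be flat.\<close>

definition wf_abaf :: "'l abaf \<Rightarrow> bool" where
  "wf_abaf D \<longleftrightarrow>
     (\<forall>(h, B) \<in> rules D. h \<in> sentences D \<and> finite B \<and> B \<subseteq> sentences D) \<and>
     assumptions D \<subseteq> sentences D \<and>
     assumptions D \<noteq> {} \<and>
     contrary D ` assumptions D \<subseteq> sentences D"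

text \<open>Finite rooted labelled trees. The label \<open>None\<close> plays the role of the extra symbol
  \<open>\<top>\<close>, which is thereby distinct from all sentences. The order of children is irrelevant
  below.\<close>

datatype 'l ltree = Node (label: "'l option") (children: "'l ltree list")

fun leaf_labels :: "'l ltree \<Rightarrow> 'l option set" where
  "leaf_labels (Node l ts) = (if ts = [] then {l} else (\<Union>t \<in> set ts. leaf_labels t))"

definition rule_step :: "'l rule \<Rightarrow> 'l option \<Rightarrow> 'l ltree list \<Rightarrow> bool" where
  "rule_step r l ts \<longleftrightarrow>
     l = Some (fst r) \<and>
     (if snd r = {} then map label ts = [None]
      else distinct (map label ts) \<and> set (map label ts) = Some ` snd r)"

fun rule_tree :: "'l rule set \<Rightarrow> 'l ltree \<Rightarrow> bool" where
  "rule_tree R (Node l ts) \<longleftrightarrow>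
     (ts \<noteq> [] \<longrightarrow> (\<exists>r \<in> R. rule_step r l ts)) \<and> (\<forall>t \<in> set ts. rule_tree R t)"

definition derives :: "'l abaf \<Rightarrow> 'l set \<Rightarrow> 'l \<Rightarrow> bool" where
  "derives D S p \<longleftrightarrow>
     S \<subseteq> assumptions D \<and> p \<in> sentences D \<and>
     (\<exists>t. rule_tree (rules D) t \<and> label t = Some p \<and>
          (leaf_labels t = Some ` S \<or> leaf_labels t = Some ` S \<union> {None}))"

definition Th :: "'l abaf \<Rightarrow> 'l set \<Rightarrow> 'l set" where
  "Th D S = {p. \<exists>S' \<subseteq> S. derives D S' p}"

definition aba_cl :: "'l abaf \<Rightarrow> 'l set \<Rightarrow> 'l set" where
  "aba_cl D S = Th D S \<inter> assumptions D"

definition aba_closed :: "'l abaf \<Rightarrow> 'l set \<Rightarrow> bool" where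
  "aba_closed D S \<longleftrightarrow> S = aba_cl D S"

definition aba_attacks :: "'l abaf \<Rightarrow> 'l set \<Rightarrow> 'l set \<Rightarrow> bool" where
  "aba_attacks D S T \<longleftrightarrow> (\<exists>a \<in> T. contrary D a \<in> Th D S)"

definition aba_conflict_free :: "'l abaf \<Rightarrow> 'l set \<Rightarrow> bool" where
  "aba_conflict_free D S \<longleftrightarrow> \<not> aba_attacks D S S"

definition aba_defends :: "'l abaf \<Rightarrow> 'l set \<Rightarrow> 'l \<Rightarrow> bool" where
  "aba_defends D S a \<longleftrightarrow>
     (\<forall>T \<subseteq> assumptions D. aba_closed D T \<and> aba_attacks D T {a} \<longrightarrow> aba_attacks D S T)"

definition aba_defends_set :: "'l abaf \<Rightarrow> 'l set \<Rightarrow> 'l set \<Rightarrow> bool" where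
  "aba_defends_set D S T \<longleftrightarrow> (\<forall>a \<in> T. aba_defends D S a)"

definition aba_ad :: "'l abaf \<Rightarrow> 'l set set" where
  "aba_ad D = {S. S \<subseteq> assumptions D \<and> aba_conflict_free D S \<and>
     aba_closed D S \<and> aba_defends_set D S S}"

definition aba_co :: "'l abaf \<Rightarrow> 'l set set" where
  "aba_co D = {S. S \<in> aba_ad D \<and>
     (\<forall>T \<subseteq> assumptions D. aba_defends_set D S T \<longrightarrow> T \<subseteq> S)}"

text \<open>If there is no complete extension then there is no grounded one; the explicit
  nonemptiness condition avoids reading the empty intersection as \<open>UNIV\<close>.\<close>

definition aba_gr :: "'l abaf \<Rightarrow> 'l set set" where
  "aba_gr D = {S. S \<subseteq> assumptions D \<and> aba_conflict_free D S \<and>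
     aba_co D \<noteq> {} \<and> S = \<Inter> (aba_co D)}"

definition aba_stb :: "'l abaf \<Rightarrow> 'l set set" where
  "aba_stb D = {S. S \<subseteq> assumptions D \<and> aba_conflict_free D S \<and>
     aba_closed D S \<and> (\<forall>x \<in> assumptions D - S. aba_attacks D S {x})}"

section \<open>Bipolar argumentation frameworks\<close>

record 'x baf =
  arguments :: "'x set"
  att :: "('x \<times> 'x) set"
  supp :: "('x \<times> 'x) set"

definition wf_baf :: "'x baf \<Rightarrow> bool" where
  "wf_baf F \<longleftrightarrow> att F \<subseteq> arguments F \<times> arguments F \<and> supp F \<subseteq> arguments F \<times> arguments F"

definition baf_cl :: "'x baf \<Rightarrow> 'x set \<Rightarrow> 'x set" where
  "baf_cl F E = (supp F)\<^sup>* `` E"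

definition baf_closed :: "'x baf \<Rightarrow> 'x set \<Rightarrow> bool" where
  "baf_closed F E \<longleftrightarrow> E = baf_cl F E"

definition attacked :: "'x baf \<Rightarrow> 'x set \<Rightarrow> 'x set" where
  "attacked F E = att F `` E"

definition baf_attacks :: "'x baf \<Rightarrow> 'x set \<Rightarrow> 'x set \<Rightarrow> bool" where
  "baf_attacks F E S \<longleftrightarrow> (\<exists>a \<in> S. a \<in> attacked F E)"

definition baf_conflict_free :: "'x baf \<Rightarrow> 'x set \<Rightarrow> bool" where
  "baf_conflict_free F E \<longleftrightarrow> E \<inter> attacked F E = {}"

definition baf_defends :: "'x baf \<Rightarrow> 'x set \<Rightarrow> 'x \<Rightarrow> bool" where
  "baf_defends F E a \<longleftrightarrow>
     (\<forall>S \<subseteq> arguments F. baf_closed F S \<and> a \<in> attacked F S \<longrightarrow> baf_attacks F E S)"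

definition defended :: "'x baf \<Rightarrow> 'x set \<Rightarrow> 'x set" where
  "defended F E = {a \<in> arguments F. baf_defends F E a}"

definition baf_ad :: "'x baf \<Rightarrow> 'x set set" where
  "baf_ad F = {E. E \<subseteq> arguments F \<and> baf_conflict_free F E \<and>
     baf_closed F E \<and> E \<subseteq> defended F E}"

definition baf_co :: "'x baf \<Rightarrow> 'x set set" where
  "baf_co F = {E. E \<in> baf_ad F \<and> E = defended F E}"

definition baf_gr :: "'x baf \<Rightarrow> 'x set set" where
  "baf_gr F = {E. E \<subseteq> arguments F \<and> baf_conflict_free F E \<and>
     baf_co F \<noteq> {} \<and> E = \<Inter> (baf_co F)}"

definition baf_stb :: "'x baf \<Rightarrow> 'x set set" where
  "baf_stb F = {E. E \<subseteq> arguments F \<and> baf_conflict_free F E \<and>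
     baf_closed F E \<and> attacked F E = arguments F - E}"

section \<open>Semantics as a parameter\<close>

datatype semantics = Ad | Co | Gr | Stb

fun aba_extensions :: "semantics \<Rightarrow> 'l abaf \<Rightarrow> 'l set set" where
  "aba_extensions Ad = aba_ad"
| "aba_extensions Co = aba_co"
| "aba_extensions Gr = aba_gr"
| "aba_extensions Stb = aba_stb"

fun baf_extensions :: "semantics \<Rightarrow> 'x baf \<Rightarrow> 'x set set" where
  "baf_extensions Ad = baf_ad"
| "baf_extensions Co = baf_co"
| "baf_extensions Gr = baf_gr"
| "baf_extensions Stb = baf_stb"

section \<open>The instantiated bipolar framework\<close>

text \<open>The pair \<open>(S, p)\<close> stands for the argument with assumption set \<open>S\<close> and conclusion
  \<open>p\<close>; different derivation trees with the same \<open>S\<close> and \<open>p\<close> give the same argument.\<close>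

type_synonym 'l argument = "'l set \<times> 'l"

definition aba_arguments :: "'l abaf \<Rightarrow> 'l argument set" where
  "aba_arguments D = {(S, p). derives D S p}"

definition instantiated_baf :: "'l abaf \<Rightarrow> 'l argument baf" where
  "instantiated_baf D =
     \<lparr> arguments = aba_arguments D,
       att = {((S, p), (T, q)) | S p T q.
                (S, p) \<in> aba_arguments D \<and> (T, q) \<in> aba_arguments D \<and> p \<in> contrary D ` T},
       supp = {((S, p), ({a}, a)) | S p a.
                (S, p) \<in> aba_arguments D \<and> ({a}, a) \<in> aba_arguments D \<and> a \<in> aba_cl D S} \<rparr>"

definition asms :: "'l argument \<Rightarrow> 'l set" where
  "asms x = fst x"

definition asms_set :: "'l argument set \<Rightarrow> 'l set" where
  "asms_set E = (\<Union>x \<in> E. asms x)"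

lemma wf_instantiated_baf: "wf_baf (instantiated_baf D)"
  by (auto simp: wf_baf_def instantiated_baf_def)

lemma derives_assumption:
  assumes "wf_abaf D" "a \<in> assumptions D"
  shows "derives D {a} a"
proof -
  have "rule_tree (rules D) (Node (Some a) [])" by simp
  moreover have "leaf_labels (Node (Some a) []) = Some ` {a}" by simp
  moreover have "a \<in> sentences D" using assms by (auto simp: wf_abaf_def)
  ultimately show ?thesis
    unfolding derives_def using assms(2) by (metis empty_subsetI insert_subset ltree.sel(1))
qed

end

theory Submission
  imports Defs
begin

text \<open>For a set \<open>S\<close> of assumptions let \<open>args_on S\<close> be the set of all arguments
  over \<open>S\<close>. Closedness, conflict-freeness and defence of \<open>S\<close> in the framework and of
  \<open>args_on S\<close> in the instantiated BAF coincide. The only delicate point is defence: a closed set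
  of arguments may have a non-closed assumption set, but an attack always comes from a single
  argument with assumptions \<open>U\<close>, and the supports put the argument of every assumption
  in the closure of \<open>U\<close> into the attacking set. Finally, complete and stable extensions
  \<open>E\<close> of the BAF all have the form \<open>args_on S\<close>, because attacks on an argument only
  depend on its assumptions.\<close>

section \<open>Closure of derivability\<close>

text \<open>Substitution of derivations for leaves: a leaf labelled by the sentence \<open>a\<close>
  becomes the tree \<open>f a\<close>, while leaves labelled \<open>None\<close> remain.\<close>

fun graft :: "('l \<Rightarrow> 'l ltree) \<Rightarrow> 'l ltree \<Rightarrow> 'l ltree" where
  "graft f (Node l ts) =
     (if ts = [] then (case l of None \<Rightarrow> Node None [] | Some a \<Rightarrow> f a)
      else Node l (map (graft f) ts))"

lemma label_graft:
  assumes "\<And>a. Some a \<in> leaf_labels t \<Longrightarrow> label (f a) = Some a"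
  shows "label (graft f t) = label t"
  using assms by (cases t) (auto split: option.split)

text \<open>Leaves labelled \<open>None\<close> survive grafting, hence the extra
  \<open>{None}\<close>. An inclusion suffices because derivability will be tested by an upper bound
  on leaf labels.\<close>

lemma leaf_labels_graft:
  "leaf_labels (graft f t) \<subseteq> (\<Union>a \<in> {a. Some a \<in> leaf_labels t}. leaf_labels (f a)) \<union> {None}"
proof (induction t)
  case (Node l ts)
  show ?case
  proof (cases "ts = []")
    case True
    then show ?thesis by (auto split: option.split)
  next
    case False
    have "leaf_labels (graft f t) \<subseteq>
        (\<Union>a \<in> {a. Some a \<in> leaf_labels (Node l ts)}. leaf_labels (f a)) \<union> {None}"
      if "t \<in> set ts" for t
    proof -
      have "leaf_labels t \<subseteq> leaf_labels (Node l ts)" using False that by auto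
      then show ?thesis using Node[OF that] by blast
    qed
    moreover have "leaf_labels (graft f (Node l ts)) = (\<Union>t \<in> set ts. leaf_labels (graft f t))"
      using False by simp
    ultimately show ?thesis by blast
  qed
qed

text \<open>\<open>rule_step\<close> sees children only through their labels, and grafting preserves
  these.\<close>

lemma rule_tree_graft:
  assumes "rule_tree R t"
    and "\<And>a. Some a \<in> leaf_labels t \<Longrightarrow> label (f a) = Some a \<and> rule_tree R (f a)"
  shows "rule_tree R (graft f t)"
  using assms
proof (induction t)
  case (Node l ts)
  show ?case
  proof (cases "ts = []")
    case True
    then show ?thesis using Node.prems by (auto split: option.split)
  next
    case False
    have "map label (map (graft f) ts) = map label ts"
      using Node.prems(2) False by (auto intro!: label_graft)
    then have "rule_step r l (map (graft f) ts) = rule_step r l ts" for r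
      unfolding rule_step_def by metis
    moreover have "rule_tree R (graft f t)" if "t \<in> set ts" for t
      using Node that False by (intro Node.IH) auto
    ultimately show ?thesis using Node.prems(1) False by simp
  qed
qed

text \<open>Absorbs the choice of \<open>S'\<close> and the optional \<open>None\<close> in the
  definition of derivability into one upper bound on leaf labels, a condition that is easy to
  maintain under grafting.\<close>

lemma label_set_iff:
  "L \<subseteq> Some ` (S \<inter> A) \<union> {None} \<longleftrightarrow>
     (\<exists>S' \<subseteq> S. S' \<subseteq> A \<and> (L = Some ` S' \<or> L = Some ` S' \<union> {None}))"
  (is "?l \<longleftrightarrow> ?r")
proof
  assume l: ?l
  define S' where "S' = {a. Some a \<in> L}"
  have "S' \<subseteq> S" "S' \<subseteq> A" using l by (auto simp: S'_def)
  moreover have "L - {None} = Some ` S'" using l by (auto simp: S'_def)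
  then have "L = Some ` S' \<or> L = Some ` S' \<union> {None}" by blast
  ultimately show ?r by (intro exI[of _ S']) simp
next
  assume ?r
  then obtain S' where "S' \<subseteq> S \<inter> A" "L = Some ` S' \<or> L = Some ` S' \<union> {None}" by blast
  moreover from this(1) have "Some ` S' \<subseteq> Some ` (S \<inter> A)" by (rule image_mono)
  ultimately show ?l by (elim disjE) (simp_all add: subset_insertI2)
qed

lemma Th_iff:
  "p \<in> Th D S \<longleftrightarrow> p \<in> sentences D \<and>
     (\<exists>t. rule_tree (rules D) t \<and> label t = Some p \<and>
          leaf_labels t \<subseteq> Some ` (S \<inter> assumptions D) \<union> {None})"
  unfolding Th_def derives_def label_set_iff mem_Collect_eq by blast

lemma Th_mono: "S \<subseteq> T \<Longrightarrow> Th D S \<subseteq> Th D T"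
  unfolding Th_def by blast

text \<open>A form of cut: each leaf taken from the closure is replaced by a derivation of it from
  \<open>S\<close>.\<close>

lemma Th_aba_cl: "Th D (aba_cl D S) \<subseteq> Th D S"
proof
  fix p assume p: "p \<in> Th D (aba_cl D S)"
  let ?L = "Some ` (S \<inter> assumptions D) \<union> {None}"
  have eq: "aba_cl D S \<inter> assumptions D = aba_cl D S" by (auto simp: aba_cl_def)
  from p[unfolded Th_iff eq] obtain t where t: "p \<in> sentences D" "rule_tree (rules D) t"
    "label t = Some p" "leaf_labels t \<subseteq> Some ` aba_cl D S \<union> {None}"
    by (elim conjE exE)
  have "\<exists>t. rule_tree (rules D) t \<and> label t = Some a \<and> leaf_labels t \<subseteq> ?L"
    if "a \<in> aba_cl D S" for a
  proof -
    have "a \<in> Th D S" using that by (simp add: aba_cl_def)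
    then show ?thesis unfolding Th_iff by (rule conjunct2)
  qed
  then have "\<forall>a \<in> aba_cl D S. \<exists>t. rule_tree (rules D) t \<and> label t = Some a \<and> leaf_labels t \<subseteq> ?L"
    by (rule ballI)
  from bchoice[OF this] obtain f where f: "\<forall>a \<in> aba_cl D S.
      rule_tree (rules D) (f a) \<and> label (f a) = Some a \<and> leaf_labels (f a) \<subseteq> ?L"
    by (elim exE)
  have leaf: "a \<in> aba_cl D S" if "Some a \<in> leaf_labels t" for a
    using subsetD[OF t(4) that] by auto
  have "label (graft f t) = Some p"
    using t(3) leaf f by (simp add: label_graft)
  moreover have "rule_tree (rules D) (graft f t)"
    using t(2) leaf f by (simp add: rule_tree_graft)
  moreover have "leaf_labels (f a) \<subseteq> ?L" if "Some a \<in> leaf_labels t" for a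
    using f leaf[OF that] by blast
  then have "leaf_labels (graft f t) \<subseteq> ?L"
    using leaf_labels_graft[of f t] by blast
  ultimately show "p \<in> Th D S" unfolding Th_iff using t(1) by (intro conjI exI)
qed

section \<open>Sets of assumptions versus sets of arguments\<close>

definition args_on :: "'l abaf \<Rightarrow> 'l set \<Rightarrow> 'l argument set" where
  "args_on D S = {x \<in> aba_arguments D. asms x \<subseteq> S}"

lemma arguments_instantiated_baf [simp]: "arguments (instantiated_baf D) = aba_arguments D"
  by (simp add: instantiated_baf_def)

lemma args_on_subset: "args_on D S \<subseteq> aba_arguments D"
  by (auto simp: args_on_def)

lemma asms_subset_assumptions: "x \<in> aba_arguments D \<Longrightarrow> asms x \<subseteq> assumptions D"
  by (auto simp: aba_arguments_def asms_def derives_def)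

section \<open>Attacks between sets of arguments\<close>

lemma aba_attacks_asms_set: "aba_attacks D S (asms_set X) \<longleftrightarrow> (\<exists>x \<in> X. aba_attacks D S (asms x))"
  by (auto simp: aba_attacks_def asms_set_def)

lemma aba_attacks_mono: "S \<subseteq> S' \<Longrightarrow> T \<subseteq> T' \<Longrightarrow> aba_attacks D S T \<Longrightarrow> aba_attacks D S' T'"
  using Th_mono unfolding aba_attacks_def by blast

text \<open>An attack is determined by the conclusion of the attacker and the assumptions of the
  target.\<close>

lemma mem_attacked_iff:
  assumes "E \<subseteq> aba_arguments D"
  shows "x \<in> attacked (instantiated_baf D) E \<longleftrightarrow>
    x \<in> aba_arguments D \<and> (\<exists>a \<in> asms x. \<exists>U. (U, contrary D a) \<in> E)"
  using assms by (cases x) (force simp: attacked_def instantiated_baf_def asms_def)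

lemma attacked_args_on:
  "attacked (instantiated_baf D) (args_on D S) = {x \<in> aba_arguments D. aba_attacks D S (asms x)}"
proof -
  \<comment> \<open>The conclusions of \<open>args_on D S\<close> are exactly the sentences
    derivable from subsets of \<open>S\<close>.\<close>
  have "(\<exists>U. (U, p) \<in> args_on D S) \<longleftrightarrow> p \<in> Th D S" for p
    by (auto simp: args_on_def asms_def aba_arguments_def Th_def)
  then show ?thesis
    by (auto simp: mem_attacked_iff[OF args_on_subset] aba_attacks_def)
qed

lemma baf_attacks_args_on:
  assumes "X \<subseteq> aba_arguments D"
  shows "baf_attacks (instantiated_baf D) (args_on D S) X \<longleftrightarrow> aba_attacks D S (asms_set X)"
  using assms by (auto simp: baf_attacks_def attacked_args_on aba_attacks_asms_set)

context
  fixes D :: "'l abaf"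
  assumes wf: "wf_abaf D"
begin

lemma singleton_argument: "a \<in> assumptions D \<Longrightarrow> ({a}, a) \<in> aba_arguments D"
  using derives_assumption[OF wf] by (simp add: aba_arguments_def)

lemma singleton_args_on: "a \<in> assumptions D \<Longrightarrow> ({a}, a) \<in> args_on D S \<longleftrightarrow> a \<in> S"
  using singleton_argument by (simp add: args_on_def asms_def)

lemma aba_cl_extensive: "S \<subseteq> assumptions D \<Longrightarrow> S \<subseteq> aba_cl D S"
  using derives_assumption[OF wf] unfolding aba_cl_def Th_def by blast

lemma aba_closed_iff: "S \<subseteq> assumptions D \<Longrightarrow> aba_closed D S \<longleftrightarrow> aba_cl D S \<subseteq> S"
  using aba_cl_extensive unfolding aba_closed_def by blast

lemma aba_closed_cl: "aba_closed D (aba_cl D S)"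
proof -
  have "aba_cl D S \<subseteq> assumptions D" by (simp add: aba_cl_def)
  moreover have "aba_cl D (aba_cl D S) \<subseteq> aba_cl D S"
    using Th_aba_cl[of D S] unfolding aba_cl_def by blast
  ultimately show ?thesis by (simp add: aba_closed_iff)
qed

text \<open>The arguments \<open>({a}, a)\<close> recover every \<open>a\<close> in
  \<open>S\<close>; this makes \<open>args_on D\<close> injective on sets of assumptions.\<close>

lemma asms_set_args_on:
  assumes "S \<subseteq> assumptions D"
  shows "asms_set (args_on D S) = S"
proof
  show "asms_set (args_on D S) \<subseteq> S" by (auto simp: asms_set_def args_on_def)
  show "S \<subseteq> asms_set (args_on D S)"
  proof
    fix a assume "a \<in> S"
    then have "({a}, a) \<in> args_on D S" using assms singleton_args_on by blast
    then show "a \<in> asms_set (args_on D S)" by (force simp: asms_set_def asms_def)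
  qed
qed

lemma args_on_inject:
  "S \<subseteq> assumptions D \<Longrightarrow> T \<subseteq> assumptions D \<Longrightarrow> args_on D S = args_on D T \<longleftrightarrow> S = T"
  using asms_set_args_on by metis

section \<open>Closedness, conflict-freeness and defence of \<open>args_on D S\<close>\<close>

text \<open>Being closed under single support edges already gives closure under their reflexive
  transitive closure, and every support edge ends in an argument \<open>({a}, a)\<close>.\<close>

lemma baf_closed_iff:
  assumes "E \<subseteq> aba_arguments D"
  shows "baf_closed (instantiated_baf D) E \<longleftrightarrow> (\<forall>x \<in> E. \<forall>a \<in> aba_cl D (asms x). ({a}, a) \<in> E)"
proof -
  have "baf_closed (instantiated_baf D) E \<longleftrightarrow> supp (instantiated_baf D) `` E \<subseteq> E"
  proof
    assume "baf_closed (instantiated_baf D) E"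
    then have "(supp (instantiated_baf D))\<^sup>* `` E = E"
      unfolding baf_closed_def baf_cl_def by (rule sym)
    moreover have "supp (instantiated_baf D) `` E \<subseteq> (supp (instantiated_baf D))\<^sup>* `` E"
      by (intro Image_mono subset_refl) auto
    ultimately show "supp (instantiated_baf D) `` E \<subseteq> E" by simp
  next
    assume "supp (instantiated_baf D) `` E \<subseteq> E"
    then show "baf_closed (instantiated_baf D) E"
      unfolding baf_closed_def baf_cl_def by (rule Image_closed_trancl[symmetric])
  qed
  also have "\<dots> \<longleftrightarrow> (\<forall>x \<in> E. \<forall>a \<in> aba_cl D (asms x). ({a}, a) \<in> E)"
  proof -
    have "y \<in> supp (instantiated_baf D) `` {x} \<longleftrightarrow> (\<exists>a \<in> aba_cl D (asms x). y = ({a}, a))"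
      if "x \<in> E" for x y
      using subsetD[OF assms that] singleton_argument
      by (cases x) (auto simp: instantiated_baf_def asms_def aba_cl_def)
    then have "supp (instantiated_baf D) `` {x} = (\<lambda>a. ({a}, a)) ` aba_cl D (asms x)"
      if "x \<in> E" for x
      using that by blast
    then have "supp (instantiated_baf D) `` E = (\<Union>x \<in> E. (\<lambda>a. ({a}, a)) ` aba_cl D (asms x))"
      by (subst Image_eq_UN) simp
    then show ?thesis by (simp add: UN_subset_iff image_subset_iff)
  qed
  finally show ?thesis .
qed

lemma baf_closed_args_on:
  assumes "S \<subseteq> assumptions D"
  shows "baf_closed (instantiated_baf D) (args_on D S) \<longleftrightarrow> aba_closed D S"
proof -
  have "aba_cl D S \<subseteq> S"
    if cl: "\<forall>x \<in> args_on D S. \<forall>a \<in> aba_cl D (asms x). ({a}, a) \<in> args_on D S"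
  proof
    fix a assume a: "a \<in> aba_cl D S"
    then obtain U where U: "U \<subseteq> S" "derives D U a" and asm: "a \<in> assumptions D"
      by (auto simp: aba_cl_def Th_def)
    \<comment> \<open>The argument \<open>(U, a)\<close> supports \<open>({a}, a)\<close>, which
      carries \<open>a\<close> into \<open>S\<close>.\<close>
    then have "(U, a) \<in> args_on D S" and "a \<in> aba_cl D U"
      by (auto simp: args_on_def aba_arguments_def asms_def aba_cl_def Th_def)
    then have "({a}, a) \<in> args_on D S" using cl by (force simp: asms_def)
    then show "a \<in> S" using asm singleton_args_on by blast
  qed
  moreover have "({a}, a) \<in> args_on D S"
    if "aba_cl D S \<subseteq> S" "x \<in> args_on D S" "a \<in> aba_cl D (asms x)" for x a
  proof -
    have "a \<in> aba_cl D S"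
      using that(2,3) Th_mono[of "asms x" S D] by (auto simp: args_on_def aba_cl_def)
    then show ?thesis
      using that(1) singleton_args_on by (auto simp: aba_cl_def)
  qed
  ultimately show ?thesis
    unfolding baf_closed_iff[OF args_on_subset] aba_closed_iff[OF assms] by blast
qed

lemma baf_conflict_free_args_on:
  assumes "S \<subseteq> assumptions D"
  shows "baf_conflict_free (instantiated_baf D) (args_on D S) \<longleftrightarrow> aba_conflict_free D S"
proof -
  have "baf_conflict_free (instantiated_baf D) (args_on D S) \<longleftrightarrow>
      \<not> baf_attacks (instantiated_baf D) (args_on D S) (args_on D S)"
    by (auto simp: baf_conflict_free_def baf_attacks_def)
  then show ?thesis
    by (simp add: baf_attacks_args_on args_on_subset asms_set_args_on assms aba_conflict_free_def)
qed

lemma baf_defends_args_on: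
  assumes "x \<in> aba_arguments D"
  shows "baf_defends (instantiated_baf D) (args_on D S) x \<longleftrightarrow> aba_defends_set D S (asms x)"
proof
  assume def: "baf_defends (instantiated_baf D) (args_on D S) x"
  show "aba_defends_set D S (asms x)"
    unfolding aba_defends_set_def aba_defends_def
  proof (intro ballI allI impI)
    fix a T assume a: "a \<in> asms x" and T: "T \<subseteq> assumptions D"
      and at: "aba_closed D T \<and> aba_attacks D T {a}"
    have "aba_attacks D T (asms x)"
      using at a aba_attacks_mono[of T T "{a}" "asms x"] by simp
    \<comment> \<open>The closed set \<open>T\<close> is turned into the closed set of arguments
      \<open>args_on D T\<close>, against which the assumed defence applies.\<close>
    then have "baf_closed (instantiated_baf D) (args_on D T)"
      and "x \<in> attacked (instantiated_baf D) (args_on D T)"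
      using assms at by (simp_all add: baf_closed_args_on attacked_args_on T)
    then have "baf_attacks (instantiated_baf D) (args_on D S) (args_on D T)"
      using def args_on_subset[of D T] by (simp add: baf_defends_def)
    then show "aba_attacks D S T"
      by (simp add: baf_attacks_args_on args_on_subset asms_set_args_on T)
  qed
next
  assume def: "aba_defends_set D S (asms x)"
  show "baf_defends (instantiated_baf D) (args_on D S) x"
    unfolding baf_defends_def arguments_instantiated_baf
  proof (intro allI impI)
    fix X assume X: "X \<subseteq> aba_arguments D"
      and at: "baf_closed (instantiated_baf D) X \<and> x \<in> attacked (instantiated_baf D) X"
    then obtain a U where a: "a \<in> asms x" and U: "(U, contrary D a) \<in> X"
      using mem_attacked_iff[OF X] by blast
    have cl: "({b}, b) \<in> X" if "b \<in> aba_cl D U" for b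
    proof -
      have "\<forall>y \<in> X. \<forall>b \<in> aba_cl D (asms y). ({b}, b) \<in> X"
        using at unfolding baf_closed_iff[OF X] by (rule conjunct1)
      from bspec[OF this U] show ?thesis using that by (simp add: asms_def)
    qed
    \<comment> \<open>\<open>U\<close> need not be closed, and defence in the framework answers only
      closed attackers; hence the passage to \<open>aba_cl D U\<close>, which still attacks
      \<open>a\<close>.\<close>
    have "derives D U (contrary D a)" using U X by (auto simp: aba_arguments_def)
    moreover have "U \<subseteq> assumptions D"
      using subsetD[OF X U] asms_subset_assumptions by (force simp: asms_def)
    ultimately have "contrary D a \<in> Th D (aba_cl D U)"
      using aba_cl_extensive[of U] by (auto simp: Th_def)
    then have "aba_attacks D (aba_cl D U) {a}" by (simp add: aba_attacks_def)
    moreover have "aba_cl D U \<subseteq> assumptions D" by (simp add: aba_cl_def)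
    ultimately have "aba_attacks D S (aba_cl D U)"
      using def a aba_closed_cl[of U] unfolding aba_defends_set_def aba_defends_def by blast
    \<comment> \<open>Since \<open>X\<close> contains \<open>({b}, b)\<close> for each
      \<open>b\<close> in this closure, the counterattack on the closure also hits
      \<open>X\<close>.\<close>
    moreover have "aba_cl D U \<subseteq> asms_set X"
    proof
      fix b assume "b \<in> aba_cl D U"
      from cl[OF this] show "b \<in> asms_set X" by (force simp: asms_set_def asms_def)
    qed
    ultimately have "aba_attacks D S (asms_set X)"
      by (rule aba_attacks_mono[OF subset_refl, rotated])
    then show "baf_attacks (instantiated_baf D) (args_on D S) X"
      by (simp add: baf_attacks_args_on X)
  qed
qed

text \<open>Defending an argument amounts to defending each of its assumptions. The fixed point
  condition for complete extensions thus becomes an equation between two sets of the form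
  \<open>args_on D T\<close>.\<close>

lemma defended_args_on:
  "defended (instantiated_baf D) (args_on D S) = args_on D {a \<in> assumptions D. aba_defends D S a}"
proof -
  have "aba_defends_set D S (asms x) \<longleftrightarrow> asms x \<subseteq> {a \<in> assumptions D. aba_defends D S a}"
    if "x \<in> aba_arguments D" for x
    using asms_subset_assumptions[OF that] by (auto simp: aba_defends_set_def)
  then show ?thesis
    unfolding defended_def args_on_def[of D "{a \<in> assumptions D. aba_defends D S a}"]
    by (intro Collect_cong) (auto simp only: baf_defends_args_on arguments_instantiated_baf)
qed

section \<open>Transfer of the semantics\<close>

text \<open>Admissible sets of arguments need not have the form \<open>args_on D S\<close>: the
  empty one is admissible even if some argument has no assumptions. So this equivalence is not
  extended to an equality of images.\<close>

lemma baf_ad_args_on: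
  assumes "S \<subseteq> assumptions D"
  shows "args_on D S \<in> baf_ad (instantiated_baf D) \<longleftrightarrow> S \<in> aba_ad D"
proof -
  have "args_on D S \<subseteq> defended (instantiated_baf D) (args_on D S) \<longleftrightarrow>
      (\<forall>x \<in> args_on D S. aba_defends_set D S (asms x))"
    using args_on_subset by (force simp: defended_def baf_defends_args_on)
  also have "\<dots> \<longleftrightarrow> aba_defends_set D S (asms_set (args_on D S))"
    by (auto simp: aba_defends_set_def asms_set_def)
  finally show ?thesis
    using assms args_on_subset
    by (auto simp: baf_ad_def aba_ad_def baf_conflict_free_args_on baf_closed_args_on
        asms_set_args_on)
qed

lemma baf_co_args_on:
  assumes "S \<subseteq> assumptions D"
  shows "args_on D S \<in> baf_co (instantiated_baf D) \<longleftrightarrow> S \<in> aba_co D"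
proof -
  let ?d = "{a \<in> assumptions D. aba_defends D S a}"
  have "args_on D S \<in> baf_co (instantiated_baf D) \<longleftrightarrow> S \<in> aba_ad D \<and> S = ?d"
    using assms by (simp add: baf_co_def baf_ad_args_on defended_args_on args_on_inject)
  \<comment> \<open>Admissibility supplies the other inclusion. As \<open>?d\<close> is the largest
    set of assumptions that \<open>S\<close> defends, what remains is completeness.\<close>
  also have "\<dots> \<longleftrightarrow> S \<in> aba_ad D \<and> ?d \<subseteq> S"
    by (auto simp: aba_ad_def aba_defends_set_def)
  also have "\<dots> \<longleftrightarrow> S \<in> aba_co D"
    unfolding aba_co_def aba_defends_set_def by blast
  finally show ?thesis .
qed

lemma baf_stb_args_on:
  assumes "S \<subseteq> assumptions D"
  shows "args_on D S \<in> baf_stb (instantiated_baf D) \<longleftrightarrow> S \<in> aba_stb D"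
proof -
  \<comment> \<open>The equivalence is relative to conflict-freeness, which both notions of
    stability include; it keeps attacked arguments out of \<open>args_on D S\<close>.\<close>
  have "attacked (instantiated_baf D) (args_on D S) = aba_arguments D - args_on D S \<longleftrightarrow>
      (\<forall>x \<in> assumptions D - S. aba_attacks D S {x})" (is "?L \<longleftrightarrow> ?R")
    if cf: "aba_conflict_free D S"
  proof
    assume L: ?L
    show ?R
    proof
      fix a assume a: "a \<in> assumptions D - S"
      then have "({a}, a) \<in> aba_arguments D - args_on D S"
        using singleton_argument singleton_args_on by simp
      then have "({a}, a) \<in> attacked (instantiated_baf D) (args_on D S)" unfolding L .
      then show "aba_attacks D S {a}" by (simp add: attacked_args_on asms_def)
    qed
  next
    assume R: ?R
    have "aba_attacks D S (asms x) \<longleftrightarrow> x \<notin> args_on D S" if x: "x \<in> aba_arguments D" for x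
    proof
      assume "aba_attacks D S (asms x)"
      then show "x \<notin> args_on D S"
        using cf aba_attacks_mono[of S S "asms x" S]
        by (auto simp: args_on_def aba_conflict_free_def)
    next
      assume "x \<notin> args_on D S"
      then obtain a where "a \<in> asms x" "a \<in> assumptions D - S"
        using x asms_subset_assumptions[OF x] by (auto simp: args_on_def)
      then show "aba_attacks D S (asms x)"
        using R by (auto simp: aba_attacks_def)
    qed
    moreover have "args_on D S \<subseteq> aba_arguments D" by (rule args_on_subset)
    ultimately show ?L unfolding attacked_args_on by blast
  qed
  then show ?thesis
    using args_on_subset[of D S]
    by (auto simp: assms baf_stb_def aba_stb_def baf_conflict_free_args_on baf_closed_args_on)
qed

section \<open>Complete and stable sets of arguments are determined by their assumptions\<close>

lemma asms_set_subset: "E \<subseteq> aba_arguments D \<Longrightarrow> asms_set E \<subseteq> assumptions D"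
  using asms_subset_assumptions by (force simp: asms_set_def)

text \<open>The attack on \<open>x\<close> targets one of its assumptions, which also occurs in some
  member of \<open>E\<close>.\<close>

lemma attacked_if_asms_attacked:
  assumes "x \<in> attacked (instantiated_baf D) X" "X \<subseteq> aba_arguments D"
    and "asms x \<subseteq> asms_set E" "E \<subseteq> aba_arguments D"
  shows "\<exists>y \<in> E. y \<in> attacked (instantiated_baf D) X"
  using assms by (fastforce simp: mem_attacked_iff asms_set_def)

text \<open>A closed attacker of an argument over \<open>asms_set E\<close> also attacks a member of
  \<open>E\<close>, so \<open>E\<close> strikes back. The argument is thus defended and, by
  completeness, in \<open>E\<close>.\<close>

lemma baf_co_eq_args_on:
  assumes "E \<in> baf_co (instantiated_baf D)"
  shows "E = args_on D (asms_set E)"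
proof
  have E: "E \<subseteq> aba_arguments D" "E = defended (instantiated_baf D) E"
    using assms by (auto simp: baf_co_def baf_ad_def)
  then show "E \<subseteq> args_on D (asms_set E)" by (auto simp: args_on_def asms_set_def)
  show "args_on D (asms_set E) \<subseteq> E"
  proof
    fix x assume x: "x \<in> args_on D (asms_set E)"
    have "baf_defends (instantiated_baf D) E x"
      unfolding baf_defends_def arguments_instantiated_baf
    proof (intro allI impI)
      fix X assume X: "X \<subseteq> aba_arguments D"
        "baf_closed (instantiated_baf D) X \<and> x \<in> attacked (instantiated_baf D) X"
      then obtain y where "y \<in> E" "y \<in> attacked (instantiated_baf D) X"
        using attacked_if_asms_attacked[of x X E] x E(1) by (auto simp: args_on_def)
      then show "baf_attacks (instantiated_baf D) E X"
        using X equalityD1[OF E(2)] by (auto simp: defended_def baf_defends_def)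
    qed
    then have "x \<in> defended (instantiated_baf D) E"
      using x by (simp add: defended_def args_on_def)
    then show "x \<in> E" using E(2) by (elim ssubst)
  qed
qed

text \<open>An argument over \<open>asms_set E\<close> outside \<open>E\<close> would be attacked by
  \<open>E\<close>; then \<open>E\<close> would attack one of its own members.\<close>

lemma baf_stb_eq_args_on:
  assumes "E \<in> baf_stb (instantiated_baf D)"
  shows "E = args_on D (asms_set E)"
proof
  have E: "E \<subseteq> aba_arguments D" "attacked (instantiated_baf D) E = aba_arguments D - E"
    using assms by (auto simp: baf_stb_def)
  then show "E \<subseteq> args_on D (asms_set E)" by (auto simp: args_on_def asms_set_def)
  show "args_on D (asms_set E) \<subseteq> E"
  proof (rule ccontr)
    assume "\<not> args_on D (asms_set E) \<subseteq> E"
    then obtain x where "asms x \<subseteq> asms_set E" "x \<in> attacked (instantiated_baf D) E"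
      using E(2) by (auto simp: args_on_def)
    then show False using attacked_if_asms_attacked E by blast
  qed
qed

section \<open>Extensions of the BAF as images under \<open>args_on D\<close>\<close>

lemma baf_co_eq_image: "baf_co (instantiated_baf D) = args_on D ` aba_co D"
proof -
  have "asms_set E \<in> aba_co D" if "E \<in> baf_co (instantiated_baf D)" for E
  proof -
    have "asms_set E \<subseteq> assumptions D"
      using that by (intro asms_set_subset) (simp add: baf_co_def baf_ad_def)
    then show ?thesis
      using that baf_co_args_on[of "asms_set E"] baf_co_eq_args_on[OF that] by simp
  qed
  moreover have "S \<subseteq> assumptions D" if "S \<in> aba_co D" for S
    using that by (simp add: aba_co_def aba_ad_def)
  then have "args_on D S \<in> baf_co (instantiated_baf D)" if "S \<in> aba_co D" for S
    using that baf_co_args_on by blast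
  ultimately show ?thesis
    using baf_co_eq_args_on by (intro set_eqI iffI) (blast intro: image_eqI)+
qed

lemma baf_stb_eq_image: "baf_stb (instantiated_baf D) = args_on D ` aba_stb D"
proof -
  have "asms_set E \<in> aba_stb D" if "E \<in> baf_stb (instantiated_baf D)" for E
  proof -
    have "asms_set E \<subseteq> assumptions D"
      using that by (intro asms_set_subset) (simp add: baf_stb_def)
    then show ?thesis
      using that baf_stb_args_on[of "asms_set E"] baf_stb_eq_args_on[OF that] by simp
  qed
  moreover have "S \<subseteq> assumptions D" if "S \<in> aba_stb D" for S
    using that by (simp add: aba_stb_def)
  then have "args_on D S \<in> baf_stb (instantiated_baf D)" if "S \<in> aba_stb D" for S
    using that baf_stb_args_on by blast
  ultimately show ?thesis
    using baf_stb_eq_args_on by (intro set_eqI iffI) (blast intro: image_eqI)+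
qed

lemma baf_gr_eq_image: "baf_gr (instantiated_baf D) = args_on D ` aba_gr D"
proof (cases "aba_co D = {}")
  case True
  then show ?thesis by (simp add: baf_gr_def aba_gr_def baf_co_eq_image)
next
  case False
  have "\<Inter> (aba_co D) \<subseteq> assumptions D"
    using False by (intro Inf_less_eq) (auto simp: aba_co_def aba_ad_def)
  \<comment> \<open>\<open>args_on D\<close> commutes with intersections of nonempty families; for
    the empty family the left side would be \<open>UNIV\<close>.\<close>
  moreover have "\<Inter> (args_on D ` aba_co D) = args_on D (\<Inter> (aba_co D))"
    using False by (auto simp: args_on_def)
  ultimately show ?thesis
    using False
    by (auto simp: baf_gr_def aba_gr_def baf_co_eq_image baf_conflict_free_args_on
        dest: subsetD[OF args_on_subset])
qed

end

theorem theorem4p3: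
  fixes D :: "'l abaf"
  assumes "wf_abaf D"
  shows "(\<forall>\<sigma> \<in> {Co, Gr, Stb}.
            (\<forall>E. E \<in> baf_extensions \<sigma> (instantiated_baf D) \<longrightarrow> asms_set E \<in> aba_extensions \<sigma> D) \<and>
            (\<forall>S. S \<in> aba_extensions \<sigma> D \<longrightarrow>
               {x \<in> arguments (instantiated_baf D). asms x \<subseteq> S}
                 \<in> baf_extensions \<sigma> (instantiated_baf D))) \<and>
         (\<forall>S. S \<in> aba_extensions Ad D \<longrightarrow>
            {x \<in> arguments (instantiated_baf D). asms x \<subseteq> S} \<in> baf_extensions Ad (instantiated_baf D))"
proof -
  have image: "baf_extensions \<sigma> (instantiated_baf D) = args_on D ` aba_extensions \<sigma> D"
    if "\<sigma> \<in> {Co, Gr, Stb}" for \<sigma>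
    using that baf_co_eq_image[OF assms] baf_gr_eq_image[OF assms] baf_stb_eq_image[OF assms]
    by auto
  have sub: "S \<subseteq> assumptions D" if "S \<in> aba_extensions \<sigma> D" for S \<sigma>
    using that by (cases \<sigma>) (auto simp only: aba_extensions.simps aba_ad_def aba_co_def aba_gr_def aba_stb_def mem_Collect_eq)
  have args: "{x \<in> arguments (instantiated_baf D). asms x \<subseteq> S} = args_on D S" for S
    by (simp add: args_on_def)
  have "asms_set E \<in> aba_extensions \<sigma> D"
    if \<sigma>: "\<sigma> \<in> {Co, Gr, Stb}" and E: "E \<in> baf_extensions \<sigma> (instantiated_baf D)" for \<sigma> E
  proof -
    obtain S where S: "S \<in> aba_extensions \<sigma> D" "E = args_on D S"
      using E unfolding image[OF \<sigma>] by blast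
    \<comment> \<open>\<open>asms_set\<close> is a left inverse of \<open>args_on D\<close> on sets
      of assumptions, so it returns \<open>S\<close> itself.\<close>
    then show ?thesis by (simp add: asms_set_args_on[OF assms sub[OF S(1)]])
  qed
  moreover have "args_on D S \<in> baf_ad (instantiated_baf D)" if "S \<in> aba_ad D" for S
    using that sub[of S Ad] baf_ad_args_on[OF assms] by simp
  ultimately show ?thesis
    unfolding args using image by simp
qed

end
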